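(* Consider any one of the class $n$ series ($n\in\{1,\dots,6\}$) of ordered tuples defined in the context (a series being determined by its class and its fixed parameters $a_i$, $b_i$, respectively $I,k,a$, while $x$, and $y$ for class 1, vary over $\mathbb{Z}$). If for some ordered tuple $(c_0,c_1,c_2,c_3,e)$ in the series there exists a quasi-smooth well-formed hypersurface of degree $e$ in $\mathbb{P}(c_0,c_1,c_2,c_3)$, then for every other ordered tuple $(c_0',c_1',c_2',c_3',e')$ in the same series (same fixed parameters, different $x$ or $y$) there exists a quasi-smooth well-formed hypersurface of degree $e'$ in $\mathbb{P}(c_0',c_1',c_2',c_3')$.
   Context: A hypersurface of degree $d$ in $\mathbb{P}(a_0,a_1,a_2,a_3)=\operatorname{Proj}\mathbb{C}[x_0,x_1,x_2,x_3]$ with $\operatorname{wt}(x_i)=a_i$ (positive integers) is given by $\phi=0$ with $\phi$ quasi-homogeneous of degree $d$. It is quasi-smooth if the affine hypersurface $\{\phi=0\}\subset\mathbb{C}^4$ has an isolated singularity at the origin (i.e. it is smooth away from the origin). It is well-formed if $\gcd(a_i,a_j,a_k)=1$ for all $i<j<k$ and $\gcd(a_i,a_j)\mid d$ for all $i<j$. The index is $I=a_0+a_1+a_2+a_3-d$. A tuple $(a_0,a_1,a_2,a_3,d)$ of positive integers is ordered if $a_0\le a_1\le a_2\le a_3\le d$. The series are the sets of all ordered tuples of one of the following forms, with the parameters other than $x,y$ fixed and $x,y\in\mathbb{Z}$ varying: Class 1: $(a_0,a_1,b_2+xm,b_3+ym,b_2+b_3+(x+y)m)$, where $a_0,a_1,b_2,b_3$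 are positive integers, $I=a_0+a_1$, $m=\operatorname{lcm}(a_0,a_1)$. Class 2: $(a_0,a_1,a_2,b_3+xm,a_1+b_3+xm)$, where $a_0,a_1,a_2,b_3$ are positive integers, $I=a_0+a_2$, $I>a_0+a_1$, $m=\operatorname{lcm}(a_0,a_1,a_2)$. Class 3: $(a_0,a_1,a_2,b_3+xm,a_0+b_3+xm)$, where $a_0,a_1,a_2,b_3$ are positive integers, $I=a_1+a_2$, $I>a_0+a_2$, $m=\operatorname{lcm}(a_0,a_1,a_2)$. Class 4: $(a_0,a_1,b_2+xm,\tfrac{a_1}{2}+b_2+xm,a_1+2b_2+2xm)$, where $a_0,a_1,b_2$ are positive integers, $a_1$ is even, $I=a_0+\tfrac{a_1}{2}$, $m=\operatorname{lcm}(a_0,\tfrac{a_1}{2})$. Class 5: $(a_0,a_1,b_2+xm,\tfrac{a_0}{2}+b_2+xm,a_0+2b_2+2xm)$, where $a_0,a_1,b_2$ are positive integers, $a_0$ is even, $I=\tfrac{a_0}{2}+a_1$, $I>a_0+\tfrac{a_1}{2}$, $m=\operatorname{lcm}(\tfrac{a_0}{2},a_1)$. Class 6: $(I-k,I+k,a+xm,a+k+xm,2a+I+k+2xm)$, where $I,k,a$ are positive integers with $k<I$, $m=\operatorname{lcm}(I-k,I+k,k)$. *)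

theory Defs
  imports "HOL-Analysis.Analysis" "HOL-Library.Poly_Mapping"
begin

text \<open>
  Polynomials in \<open>\<complex>[x\<^sub>0, x\<^sub>1, x\<^sub>2, x\<^sub>3]\<close>: finitely supported coefficient functions on exponent
  vectors. The variables are indexed by the type \<open>4\<close>, whose elements are \<open>0, 1, 2, 3\<close>.
\<close>

type_synonym poly4 = "(4 \<Rightarrow>\<^sub>0 nat) \<Rightarrow>\<^sub>0 complex"

definition eval4 :: "poly4 \<Rightarrow> complex ^ 4 \<Rightarrow> complex" where
  "eval4 p x =
     (\<Sum>m\<in>Poly_Mapping.keys p.
        Poly_Mapping.lookup p m * (\<Prod>i\<in>UNIV. x $ i ^ Poly_Mapping.lookup m i))"

text \<open>
  Formal partial derivative. If \<open>x\<^sub>i\<close> does not occur in the monomial \<open>m\<close>, the subtraction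
  truncates, but the coefficient is then \<open>0\<close>.
\<close>

definition partial4 :: "4 \<Rightarrow> poly4 \<Rightarrow> poly4" where
  "partial4 i p =
     (\<Sum>m\<in>Poly_Mapping.keys p.
        Poly_Mapping.single (m - Poly_Mapping.single i 1)
          (of_nat (Poly_Mapping.lookup m i) * Poly_Mapping.lookup p m))"

type_synonym weights = "4 \<Rightarrow> int"

definition wts :: "int \<Rightarrow> int \<Rightarrow> int \<Rightarrow> int \<Rightarrow> weights" where
  "wts a0 a1 a2 a3 = (\<lambda>i. if i = 0 then a0 else if i = 1 then a1 else if i = 2 then a2 else a3)"

definition quasi_homogeneous :: "weights \<Rightarrow> int \<Rightarrow> poly4 \<Rightarrow> bool" where
  "quasi_homogeneous a d \<phi> \<longleftrightarrow>
     (\<forall>m\<in>Poly_Mapping.keys \<phi>. (\<Sum>i\<in>UNIV. a i * int (Poly_Mapping.lookup m i)) = d)"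

text \<open>
  The affine hypersurface \<open>\<phi> = 0\<close> in \<open>\<complex>\<^sup>4\<close> is smooth away from the origin. The zero polynomial is
  not quasi-smooth, so \<open>\<phi> \<noteq> 0\<close> need not be required separately.
\<close>

definition quasi_smooth :: "poly4 \<Rightarrow> bool" where
  "quasi_smooth \<phi> \<longleftrightarrow>
     (\<forall>x. x \<noteq> 0 \<longrightarrow> eval4 \<phi> x = 0 \<longrightarrow> (\<exists>i. eval4 (partial4 i \<phi>) x \<noteq> 0))"

definition well_formed :: "weights \<Rightarrow> int \<Rightarrow> bool" where
  "well_formed a d \<longleftrightarrow>
     (\<forall>i j k. i \<noteq> j \<and> j \<noteq> k \<and> i \<noteq> k \<longrightarrow> gcd (gcd (a i) (a j)) (a k) = 1) \<and>
     (\<forall>i j. i \<noteq> j \<longrightarrow> gcd (a i) (a j) dvd d)"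

text \<open>\<open>\<phi>\<close> defines a quasi-smooth well-formed hypersurface of degree \<open>d\<close> in \<open>\<P>(a\<^sub>0, a\<^sub>1, a\<^sub>2, a\<^sub>3)\<close>.\<close>

definition qs_wf_hypersurface :: "weights \<Rightarrow> int \<Rightarrow> poly4 \<Rightarrow> bool" where
  "qs_wf_hypersurface a d \<phi> \<longleftrightarrow>
     (\<forall>i. 0 < a i) \<and> quasi_homogeneous a d \<phi> \<and> quasi_smooth \<phi> \<and> well_formed a d"

type_synonym wtuple = "int \<times> int \<times> int \<times> int \<times> int"

fun ordered :: "wtuple \<Rightarrow> bool" where
  "ordered (a0, a1, a2, a3, d) \<longleftrightarrow> 0 < a0 \<and> a0 \<le> a1 \<and> a1 \<le> a2 \<and> a2 \<le> a3 \<and> a3 \<le> d"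

fun index :: "wtuple \<Rightarrow> int" where
  "index (a0, a1, a2, a3, d) = a0 + a1 + a2 + a3 - d"

text \<open>
  \<open>series n I S\<close>: \<open>S\<close> is a series of class \<open>n\<close> of tuples of index \<open>I\<close>. That all members of \<open>S\<close>
  have index \<open>I\<close> follows from their shape, see \<open>series_index\<close> below.
\<close>

inductive series :: "nat \<Rightarrow> int \<Rightarrow> wtuple set \<Rightarrow> bool" where
  class1:
    "series 1 I {t. ordered t \<and>
       (\<exists>x y. t = (a0, a1, b2 + x * m, b3 + y * m, b2 + b3 + (x + y) * m))}"
    if "0 < a0" "0 < a1" "0 < b2" "0 < b3"
      "I = a0 + a1" "m = lcm a0 a1"
| class2:
    "series 2 I {t. ordered t \<and>
       (\<exists>x. t = (a0, a1, a2, b3 + x * m, a1 + b3 + x * m))}"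
    if "0 < a0" "0 < a1" "0 < a2" "0 < b3"
      "I = a0 + a2" "I > a0 + a1" "m = lcm (lcm a0 a1) a2"
| class3:
    "series 3 I {t. ordered t \<and>
       (\<exists>x. t = (a0, a1, a2, b3 + x * m, a0 + b3 + x * m))}"
    if "0 < a0" "0 < a1" "0 < a2" "0 < b3"
      "I = a1 + a2" "I > a0 + a2" "m = lcm (lcm a0 a1) a2"
| class4:
    "series 4 I {t. ordered t \<and>
       (\<exists>x. t = (a0, a1, b2 + x * m, a1 div 2 + b2 + x * m, a1 + 2 * b2 + 2 * x * m))}"
    if "0 < a0" "0 < a1" "0 < b2" "even a1"
      "I = a0 + a1 div 2" "m = lcm a0 (a1 div 2)"
| class5:
    "series 5 I {t. ordered t \<and>
       (\<exists>x. t = (a0, a1, b2 + x * m, a0 div 2 + b2 + x * m, a0 + 2 * b2 + 2 * x * m))}"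
    if "0 < a0" "0 < a1" "0 < b2" "even a0"
      "I = a0 div 2 + a1" "real_of_int I > real_of_int a0 + real_of_int a1 / 2"
      "m = lcm (a0 div 2) a1"
| class6:
    "series 6 I {t. ordered t \<and>
       (\<exists>x. t = (I - k, I + k, a + x * m, a + k + x * m, 2 * a + I + k + 2 * x * m))}"
    if "0 < I" "0 < k" "0 < a" "k < I"
      "m = lcm (lcm (I - k) (I + k)) k"

lemma series_index: "series n I S \<Longrightarrow> t \<in> S \<Longrightarrow> index t = I"
  by (induction rule: series.induct) (auto simp: algebra_simps)

text \<open>The formal partial derivatives are the analytic ones:\<close>

lemma eval4_superset:
  assumes "finite A" "Poly_Mapping.keys p \<subseteq> A"
  shows "eval4 p x = (\<Sum>m\<in>A. Poly_Mapping.lookup p m * (\<Prod>i\<in>UNIV. x $ i ^ Poly_Mapping.lookup m i))"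
  unfolding eval4_def
  by (rule sum.mono_neutral_left) (use assms in \<open>auto simp: in_keys_iff\<close>)

lemma eval4_add: "eval4 (p + q) x = eval4 p x + eval4 q x"
proof -
  have "finite (Poly_Mapping.keys p \<union> Poly_Mapping.keys q)" by simp
  from eval4_superset[OF this] show ?thesis
    using Poly_Mapping.keys_add[of p q]
    by (simp add: lookup_add algebra_simps sum.distrib)
qed

lemma eval4_zero: "eval4 0 x = 0"
  by (simp add: eval4_def)

lemma eval4_sum: "eval4 (sum f A) x = (\<Sum>a\<in>A. eval4 (f a) x)"
  by (induction A rule: infinite_finite_induct) (auto simp: eval4_zero eval4_add)

lemma eval4_single:
  "eval4 (Poly_Mapping.single m c) x = c * (\<Prod>i\<in>UNIV. x $ i ^ Poly_Mapping.lookup m i)"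
  by (simp add: eval4_def)

lemma partial4_has_field_derivative:
  "((\<lambda>z. eval4 p (\<chi> j. if j = i then z else x $ j))
      has_field_derivative eval4 (partial4 i p) x) (at (x $ i))"
proof -
  have split: "(\<Prod>j\<in>UNIV. f j) = f i * (\<Prod>j\<in>UNIV - {i}. f j)" for f :: "4 \<Rightarrow> complex"
    by (simp add: prod.remove)
  have 1: "(\<Prod>j\<in>UNIV. (\<chi> j. if j = i then z else x $ j) $ j ^ Poly_Mapping.lookup m j)
      = z ^ Poly_Mapping.lookup m i * (\<Prod>j\<in>UNIV - {i}. x $ j ^ Poly_Mapping.lookup m j)" for z m
    unfolding split by (simp cong: prod.cong_simp)
  have 2: "(\<Prod>j\<in>UNIV. x $ j ^ Poly_Mapping.lookup (m - Poly_Mapping.single i 1) j)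
      = x $ i ^ (Poly_Mapping.lookup m i - 1) * (\<Prod>j\<in>UNIV - {i}. x $ j ^ Poly_Mapping.lookup m j)" for m
    unfolding split
    by (auto simp: lookup_minus lookup_single intro!: prod.cong)
  show ?thesis
    unfolding partial4_def eval4_sum eval4_single eval4_def[of p] 1 2
    by (auto intro!: derivative_eq_intros sum.cong)
qed

end

theory Submission
  imports Defs
begin

text \<open>
  A quasi-smooth \<open>\<phi>\<close> of degree \<open>d\<close> contains, for each \<open>i\<close>, a monomial \<open>x\<^sub>i\<^bsup>n\<^esup> x\<^sub>j\<close>, so that \<open>a\<^sub>i\<close>
  divides \<open>d - a\<^sub>j\<close> for some \<open>j\<close>. In every class two of the variables are already served by monomials
  that the shape of the tuple forces to have degree \<open>d\<close> (\<open>x\<^sub>2 x\<^sub>3\<close>, or \<open>x\<^sub>3\<^sup>2\<close> and \<open>x\<^sub>2\<^sup>2 x\<^sub>1\<close>, or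
  \<open>x\<^sub>2\<^sup>2 x\<^sub>1\<close> and \<open>x\<^sub>3\<^sup>2 x\<^sub>0\<close>, up to renaming). For the other two, well-formedness leaves only those
  \<open>j\<close> for which the chosen monomials form an invertible polynomial, that is, a sum of Fermat, chain
  and loop polynomials in disjoint sets of variables, and these are quasi-smooth. The
  divisibilities involved are invariant under the shifts by multiples of \<open>m\<close>, hence hold for the
  whole series.
\<close>

section \<open>Monomials forced by quasi-smoothness at the coordinate points\<close>

text \<open>At the coordinate point of \<open>x_i\<close> only powers of \<open>x_i\<close> survive.
  If \<phi> is nonzero there, it contains some \<open>x_i^n\<close>, which gives
  \<open>j = i\<close>; otherwise some derivative along \<open>x_j\<close> is nonzero and \<phi>
  contains some \<open>x_i^n x_j\<close>.\<close>

lemma quasi_smooth_vertex: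
  assumes qh: "quasi_homogeneous a d \<phi>" and qs: "quasi_smooth \<phi>"
  obtains j where "a i dvd d - a j"
proof -
  define x :: "complex ^ 4" where "x = axis i 1"
  have "x \<noteq> 0" by (simp add: x_def axis_eq_0_iff)
  have mon: "(\<forall>l. l \<noteq> i \<longrightarrow> Poly_Mapping.lookup m l = 0)"
    if "(\<Prod>l\<in>UNIV. x $ l ^ Poly_Mapping.lookup m l) \<noteq> 0" for m
    using that by (auto simp: x_def axis_def split: if_splits)
  have split: "(\<Sum>l\<in>UNIV. a l * int (Poly_Mapping.lookup m l)) = a i * int (Poly_Mapping.lookup m i)
      + (\<Sum>l\<in>UNIV - {i}. a l * int (Poly_Mapping.lookup m l))" for m
    by (simp add: sum.remove)
  show ?thesis
  proof (cases "eval4 \<phi> x = 0")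
    case False
    then obtain m where m: "m \<in> Poly_Mapping.keys \<phi>"
        "(\<Prod>l\<in>UNIV. x $ l ^ Poly_Mapping.lookup m l) \<noteq> 0"
      unfolding eval4_def by (metis (no_types, lifting) mult_eq_0_iff sum.neutral)
    have "(\<Sum>l\<in>UNIV - {i}. a l * int (Poly_Mapping.lookup m l)) = 0"
      using mon[OF m(2)] by (intro sum.neutral) auto
    then have "d = a i * int (Poly_Mapping.lookup m i)"
      using qh m(1) split[of m] unfolding quasi_homogeneous_def by auto
    then show ?thesis using that[of i] by simp
  next
    case True
    then obtain j where "eval4 (partial4 j \<phi>) x \<noteq> 0"
      using qs \<open>x \<noteq> 0\<close> unfolding quasi_smooth_def by blast
    then obtain m where m: "m \<in> Poly_Mapping.keys \<phi>" "Poly_Mapping.lookup m j \<noteq> 0"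
        "(\<Prod>l\<in>UNIV. x $ l ^ Poly_Mapping.lookup (m - Poly_Mapping.single j 1) l) \<noteq> 0"
      unfolding partial4_def eval4_sum eval4_single
      by (metis (no_types, lifting) mult_eq_0_iff of_nat_0 sum.neutral)
    have "(\<Sum>l\<in>UNIV. a l * int (Poly_Mapping.lookup m l)) =
       (\<Sum>l\<in>UNIV. a l * int (Poly_Mapping.lookup (m - Poly_Mapping.single j 1) l) + (if l = j then a l else 0))"
      using m(2) by (intro sum.cong) (auto simp: lookup_minus lookup_single when_def algebra_simps of_nat_diff)
    also have "\<dots> = a i * int (Poly_Mapping.lookup (m - Poly_Mapping.single j 1) i) + a j"
      unfolding sum.distrib split using mon[OF m(3)] by (simp add: sum.neutral)
    finally have "d = a i * int (Poly_Mapping.lookup (m - Poly_Mapping.single j 1) i) + a j"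
      using qh m(1) unfolding quasi_homogeneous_def by auto
    then show ?thesis using that[of j] by simp
  qed
qed

section \<open>Quasi-smoothness of graph polynomials\<close>

text \<open>
  The polynomial \<open>\<Sum>\<^sub>i x\<^sub>i\<^bsup>n i\<^esup> x\<^bsub>s i\<^esub>\<close>. Fixed points of \<open>s\<close> give Fermat terms, cycles give loops.
\<close>

definition graph_poly :: "(4 \<Rightarrow> 4) \<Rightarrow> (4 \<Rightarrow> nat) \<Rightarrow> poly4" where
  "graph_poly s n = (\<Sum>i\<in>UNIV.
     Poly_Mapping.single (Poly_Mapping.single i (n i) + Poly_Mapping.single (s i) 1) 1)"

lemma prod_power_when:
  fixes x :: "complex ^ 4"
  shows "(\<Prod>l\<in>UNIV. x $ l ^ (k when i = l)) = x $ i ^ k"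
proof -
  have "(\<Prod>l\<in>UNIV. x $ l ^ (k when i = l)) = (\<Prod>l\<in>UNIV. if l = i then x $ l ^ k else 1)"
    by (intro prod.cong) (auto simp: when_def)
  then show ?thesis by simp
qed

lemma eval4_graph_poly:
  "eval4 (graph_poly s n) x = (\<Sum>i\<in>UNIV. x $ i ^ n i * x $ s i)"
  unfolding graph_poly_def eval4_sum eval4_single lookup_add lookup_single power_add
    prod.distrib prod_power_when by simp

text \<open>Obtained from uniqueness of the analytic derivative. This bypasses the formal sum, in
  which monomials can coincide: a two-cycle of \<open>s\<close> with exponents 1 contributes
  \<open>2 x_i x_j\<close>.\<close>

lemma eval4_partial4_graph_poly:
  "eval4 (partial4 j (graph_poly s n)) x =
     of_nat (n j) * x $ j ^ (n j - 1) * x $ s j + (\<Sum>i | s i = j. x $ i ^ n i)"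
proof -
  have "((\<lambda>z. eval4 (graph_poly s n) (\<chi> l. if l = j then z else x $ l)) has_field_derivative
      (\<Sum>i\<in>UNIV. (if i = j then of_nat (n i) * x $ i ^ (n i - 1) * x $ s i else 0)
         + (if s i = j then x $ i ^ n i else 0))) (at (x $ j))"
    unfolding eval4_graph_poly
  proof (rule DERIV_sum)
    fix i :: 4
    show "((\<lambda>z. (\<chi> l. if l = j then z else x $ l) $ i ^ n i * (\<chi> l. if l = j then z else x $ l) $ s i)
       has_field_derivative (if i = j then of_nat (n i) * x $ i ^ (n i - 1) * x $ s i else 0)
         + (if s i = j then x $ i ^ n i else 0)) (at (x $ j))"
      by (cases "i = j"; cases "s i = j") (auto intro!: derivative_eq_intros)
  qed
  from DERIV_unique[OF partial4_has_field_derivative this]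
  show ?thesis by (simp add: sum.distrib sum.If_cases)
qed

lemma quasi_homogeneous_graph_poly:
  assumes "\<And>i. a i * int (n i) + a (s i) = d"
  shows "quasi_homogeneous a d (graph_poly s n)"
  unfolding quasi_homogeneous_def
proof
  fix m assume "m \<in> Poly_Mapping.keys (graph_poly s n)"
  then obtain i where m: "m = Poly_Mapping.single i (n i) + Poly_Mapping.single (s i) 1"
    unfolding graph_poly_def
    using keys_sum[of "\<lambda>i. Poly_Mapping.single (Poly_Mapping.single i (n i) + Poly_Mapping.single (s i) 1) (1::complex)" UNIV]
    by (auto split: if_splits)
  have "(\<Sum>l\<in>UNIV. a l * int (Poly_Mapping.lookup m l)) =
      (\<Sum>l\<in>UNIV. (if l = i then a l * int (n i) else 0) + (if l = s i then a l else 0))"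
    unfolding m by (intro sum.cong) (auto simp: lookup_add lookup_single when_def algebra_simps)
  also have "\<dots> = d" unfolding sum.distrib using assms[of i] by simp
  finally show "(\<Sum>l\<in>UNIV. a l * int (Poly_Mapping.lookup m l)) = d" .
qed

text \<open>
  Exponent 1 must be restricted: the loop \<open>x\<^sub>0 x\<^sub>2 + x\<^sub>2 x\<^sub>1 + x\<^sub>1 x\<^sub>3 + x\<^sub>3 x\<^sub>0 = (x\<^sub>0 + x\<^sub>1) (x\<^sub>2 + x\<^sub>3)\<close>
  is not quasi-smooth.
\<close>

lemma quasi_smooth_graph_poly:
  assumes pos: "\<And>i. 0 < n i"
    and inj: "\<And>i j. s i = s j \<Longrightarrow> i = j \<or> s i = i \<or> s j = j"
    and exps: "\<And>i. s i \<noteq> i \<Longrightarrow> s (s i) = s i \<or> 2 \<le> n (s i) \<or> (s (s i) = i \<and> n i = 1 \<and> n (s i) = 1)"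
  shows "quasi_smooth (graph_poly s n)"
  unfolding quasi_smooth_def
proof (intro allI impI, rule ccontr)
  fix x :: "complex ^ 4"
  assume "x \<noteq> 0" and "\<not> (\<exists>j. eval4 (partial4 j (graph_poly s n)) x \<noteq> 0)"
  then have D: "of_nat (n j) * x $ j ^ (n j - 1) * x $ s j + (\<Sum>i | s i = j. x $ i ^ n i) = 0" for j
    by (simp add: eval4_partial4_graph_poly)
  \<comment> \<open>By \<open>inj\<close>, the only index besides \<open>i\<close> that can map to
    \<open>s i\<close> is \<open>s i\<close> itself, as a fixed point.\<close>
  have preds: "{l. s l = s i} = (if s (s i) = s i then {i, s i} else {i})" if "s i \<noteq> i" for i
    using inj[of i] that by (auto; metis)
  define T where "T i = x $ i ^ n i * x $ s i" for i
  have pow: "x $ j ^ (n j - 1) * x $ j = x $ j ^ n j" for j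
    using pos[of j] by (metis Suc_diff_1 power_Suc2)
  text \<open>Euler: \<open>x\<^sub>j \<partial>\<^sub>j\<close> turns the equations into a linear system in the monomials.\<close>
  have E: "of_nat (n j) * T j + (\<Sum>i | s i = j. T i) = 0" for j
  proof -
    have "of_nat (n j) * T j + (\<Sum>i | s i = j. T i) =
       x $ j * (of_nat (n j) * x $ j ^ (n j - 1) * x $ s j + (\<Sum>i | s i = j. x $ i ^ n i))"
      by (simp add: T_def sum_distrib_left distrib_left flip: pow) (simp add: algebra_simps)
    then show ?thesis using D by simp
  qed
  text \<open>So a monomial of maximal modulus vanishes.\<close>
  have grow: "T j = 0 \<or> (\<exists>i. 2 * norm (T j) \<le> norm (T i))" for j
  proof (cases "\<exists>i. i \<noteq> j \<and> s i = j")
    case False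
    then have "{i. s i = j} = (if s j = j then {j} else {})" by (auto; metis)
    then have "of_nat (n j + (if s j = j then 1 else 0)) * T j = 0"
      using E[of j] by (auto simp: algebra_simps split: if_splits)
    then show ?thesis using pos[of j] by (auto simp del: of_nat_add)
  next
    case True
    then obtain i where i: "i \<noteq> j" "s i = j" by auto
    \<comment> \<open>With \<open>i\<close> as the only other predecessor, \<open>E\<close> gives
      \<open>T i = - c * T j\<close>, where \<open>c\<close> is \<open>n j + 1\<close> at a fixed
      point and \<open>n j\<close> elsewhere, so at least 2 in the first two cases. In a two-cycle
      with exponents 1 both monomials are \<open>x_i x_j\<close>, and \<open>E\<close> becomes
      \<open>2 * T j = 0\<close>.\<close>
    consider "s j = j" | "2 \<le> n j" "s j \<noteq> j" | "s j = i" "n i = 1" "n j = 1"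
      using exps[of i] i by auto
    then show ?thesis
    proof cases
      case 1
      then have "T i = - (of_nat (n j + 1) * T j)"
        using E[of j] preds[of i] i by (simp add: algebra_simps eq_neg_iff_add_eq_0)
      then have "norm (T i) = real (n j + 1) * norm (T j)"
        by (simp only: norm_minus_cancel norm_mult norm_of_nat)
      then show ?thesis using pos[of j] by (auto intro!: exI[of _ i] mult_right_mono)
    next
      case 2
      then have "T i = - (of_nat (n j) * T j)"
        using E[of j] preds[of i] i by (simp add: algebra_simps eq_neg_iff_add_eq_0)
      then have "norm (T i) = real (n j) * norm (T j)"
        by (simp only: norm_minus_cancel norm_mult norm_of_nat)
      then show ?thesis using 2 by (auto intro!: exI[of _ i] mult_right_mono)
    next
      case 3
      then have "T i = T j" using i by (simp add: T_def)
      then show ?thesis using E[of j] preds[of i] i 3 by simp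
    qed
  qed
  have T0: "T i = 0" for i
  proof -
    have "Max (range (\<lambda>i. norm (T i))) \<in> range (\<lambda>i. norm (T i))" by (intro Max_in) auto
    then obtain j where "Max (range (\<lambda>i. norm (T i))) = norm (T j)" by blast
    then have j: "norm (T i) \<le> norm (T j)" for i
      by (metis Max_ge finite finite_imageI rangeI)
    have "T j = 0" using grow[of j] j by (smt (verit) norm_ge_zero norm_eq_zero)
    then show ?thesis using j[of i] by simp
  qed
  \<comment> \<open>A nonzero coordinate \<open>x_i\<close> forces \<open>x_(s i) = 0\<close>. In
    the derivative along \<open>x_(s i)\<close> only \<open>x_i^(n i)\<close> then survives, or
    \<open>2 x_i\<close> in the exceptional two-cycle, and neither vanishes.\<close>
  obtain i where i: "x $ i \<noteq> 0" using \<open>x \<noteq> 0\<close> by (auto simp: vec_eq_iff)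
  then have sx: "x $ s i = 0" using T0[of i] by (auto simp: T_def)
  then have ne: "s i \<noteq> i" using i by auto
  consider "s (s i) = s i" | "s (s i) \<noteq> s i" "2 \<le> n (s i)" | "s (s i) = i" "n i = 1" "n (s i) = 1"
    using exps[OF ne] by auto
  then show False
  proof cases
    case 1
    then have "{l. s l = s i} = {i, s i}" using preds[OF ne] by simp
    then show False using D[of "s i"] 1 ne i sx pos[of "s i"] by (simp add: zero_power)
  next
    case 2
    then have "{l. s l = s i} = {i}" using preds[OF ne] by simp
    then show False using D[of "s i"] 2 i sx by (simp add: zero_power)
  next
    case 3
    then have "{l. s l = s i} = {i}" using preds[OF ne] ne by simp
    then show False using D[of "s i"] 3 i by simp
  qed
qed

text \<open>The exponents are \<open>(d - a (s i)) / a i\<close>, integral by \<open>dvd\<close> and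
  positive by \<open>less\<close>. Exponent 1 at \<open>s i\<close> means
  \<open>a (s i) + a (s (s i)) = d\<close>, so \<open>exps\<close> expresses the restriction on
  exponents through weights.\<close>

lemma graph_hypersurface:
  fixes a :: weights
  assumes pos: "\<And>i. 0 < a i"
    and less: "\<And>i. a (s i) < d"
    and dvd: "\<And>i. a i dvd d - a (s i)"
    and inj: "\<And>i j. s i = s j \<Longrightarrow> i = j \<or> s i = i \<or> s j = j"
    and exps: "\<And>i. s i \<noteq> i \<Longrightarrow> s (s i) = s i \<or> s (s i) = i \<or> a (s i) + a (s (s i)) \<noteq> d"
  shows "\<exists>\<phi>. quasi_homogeneous a d \<phi> \<and> quasi_smooth \<phi>"
proof -
  define n where "n i = nat ((d - a (s i)) div a i)" for i
  have n: "a i * int (n i) + a (s i) = d" "0 < n i" for i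
  proof -
    obtain q where q: "d - a (s i) = a i * q" using dvd[of i] by auto
    then have "0 < q" using less[of i] pos[of i] by (metis diff_gt_0_iff_gt zero_less_mult_pos)
    then show "a i * int (n i) + a (s i) = d" "0 < n i"
      using q pos[of i] by (simp_all add: n_def)
  qed
  have "quasi_smooth (graph_poly s n)"
  proof (rule quasi_smooth_graph_poly)
    fix i assume i: "s i \<noteq> i"
    show "s (s i) = s i \<or> 2 \<le> n (s i) \<or> (s (s i) = i \<and> n i = 1 \<and> n (s i) = 1)"
    proof (cases "n (s i) = 1")
      case True
      then have "a (s i) + a (s (s i)) = d" using n(1)[of "s i"] by simp
      then have "s (s i) = s i \<or> s (s i) = i" using exps[OF i] by auto
      \<comment> \<open>In a two-cycle the equation \<open>a i + a (s i) = d\<close> is symmetric,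
        so exponent 1 at one vertex forces it at the other.\<close>
      moreover have "n i = 1" if "s (s i) = i"
      proof -
        have "a i * int (n i) = a i * 1"
          using n(1)[of i] \<open>a (s i) + a (s (s i)) = d\<close> unfolding that by linarith
        then show ?thesis using pos[of i] by (metis mult_cancel_left of_nat_eq_1_iff less_irrefl)
      qed
      ultimately show ?thesis using True by auto
    qed (use n(2)[of "s i"] in auto)
  qed (use n inj in auto)
  then show ?thesis using quasi_homogeneous_graph_poly[of a n s d] n(1) by blast
qed

section \<open>Well-formedness under congruences of the weights\<close>

lemma well_formed_unit:
  assumes "well_formed a d" "i \<noteq> j" "j \<noteq> k" "i \<noteq> k" "g dvd a i" "g dvd a j" "g dvd a k"
  shows "g dvd 1"
  using assms unfolding well_formed_def by (metis gcd_greatest)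

lemma well_formed_dvd:
  assumes "well_formed a d" "i \<noteq> j" "g dvd a i" "g dvd a j"
  shows "g dvd d"
  using assms unfolding well_formed_def by (metis gcd_greatest dvd_trans)

text \<open>A common divisor of new weights that divides \<open>m\<close> also divides the
  corresponding old weights, where well-formedness applies, and the result carries back from
  \<open>d\<close> to \<open>d'\<close>. Only divisors not dividing \<open>m\<close> need a direct
  argument.\<close>

lemma well_formed_cong:
  fixes a a' :: weights
  assumes wf: "well_formed a d" and a': "\<And>i. m dvd a' i - a i" and d': "m dvd d' - d"
    and triple: "\<And>i j k g. i \<noteq> j \<Longrightarrow> j \<noteq> k \<Longrightarrow> i \<noteq> k \<Longrightarrow>
      g dvd a' i \<Longrightarrow> g dvd a' j \<Longrightarrow> g dvd a' k \<Longrightarrow> g dvd m"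
    and pair: "\<And>i j g. i \<noteq> j \<Longrightarrow> g dvd a' i \<Longrightarrow> g dvd a' j \<Longrightarrow> g dvd m \<or> g dvd d'"
  shows "well_formed a' d'"
proof -
  have down: "g dvd a i" if "g dvd m" "g dvd a' i" for g i
    using dvd_diff[OF that(2) dvd_trans[OF that(1) a'[of i]]] by simp
  have up: "g dvd d'" if "g dvd m" "g dvd d" for g
    using dvd_add[OF that(2) dvd_trans[OF that(1) d']] by simp
  show ?thesis
    unfolding well_formed_def
  proof (intro conjI allI impI)
    fix i j k :: 4 assume ne: "i \<noteq> j \<and> j \<noteq> k \<and> i \<noteq> k"
    let ?g = "gcd (gcd (a' i) (a' j)) (a' k)"
    have g: "?g dvd a' i" "?g dvd a' j" "?g dvd a' k" by (auto intro: dvd_trans[OF gcd_dvd1])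
    then have "?g dvd m" using triple ne by blast
    then have "?g dvd 1" using well_formed_unit[OF wf] down g ne by metis
    then show "?g = 1" by simp
  next
    fix i j :: 4 assume ne: "i \<noteq> j"
    let ?g = "gcd (a' i) (a' j)"
    show "?g dvd d'"
      using pair[OF ne gcd_dvd1 gcd_dvd2] down[of ?g] up[of ?g] well_formed_dvd[OF wf ne, of ?g]
      by (meson gcd_dvd1 gcd_dvd2)
  qed
qed

section \<open>Invertible polynomials of the three shapes\<close>

lemma UNIV_4_distinct:
  assumes "distinct [i, j, k, l :: 4]"
  shows "x = i \<or> x = j \<or> x = k \<or> x = l"
proof -
  have "card {i, j, k, l} = card (UNIV :: 4 set)" using assms by simp
  then have "{i, j, k, l} = (UNIV :: 4 set)" by (metis card_subset_eq finite subset_UNIV)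
  then show ?thesis by blast
qed

text \<open>The indices \<open>i\<close> and \<open>j\<close> form a two-cycle with exponents 1,
  contributing \<open>2 x_i x_j\<close>. The other two give Fermat terms, a chain or a loop among
  themselves.\<close>

lemma hypersurface_xy:
  fixes a :: weights
  assumes dist: "distinct [i, j, k, l]" and pos: "\<And>i. 0 < a i"
    and d: "d = a i + a j" and less: "a k < d" "a l < d"
    and k: "a k dvd d \<or> a k dvd d - a l" and l: "a l dvd d \<or> a l dvd d - a k"
  shows "\<exists>\<phi>. quasi_homogeneous a d \<phi> \<and> quasi_smooth \<phi>"
proof -
  define s where "s = id(i := j, j := i, k := if a k dvd d then k else l, l := if a l dvd d then l else k)"
  have s: "s i = j" "s j = i" "s k = (if a k dvd d then k else l)" "s l = (if a l dvd d then l else k)"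
    using dist by (auto simp: s_def)
  note U = UNIV_4_distinct[OF dist]
  show ?thesis
  proof (rule graph_hypersurface[OF pos])
    fix x y
    show "a (s x) < d" using U[of x] pos[of i] pos[of j] less d by (auto simp: s)
    show "a x dvd d - a (s x)" using U[of x] d k l by (auto simp: s)
    show "x = y \<or> s x = x \<or> s y = y" if "s x = s y"
      using that U[of x] U[of y] dist by (auto simp: s split: if_splits)
    show "s (s x) = s x \<or> s (s x) = x \<or> a (s x) + a (s (s x)) \<noteq> d" if "s x \<noteq> x"
      using U[of x] by (elim disjE) (simp_all add: s)
  qed
qed

text \<open>The polynomial is \<open>x_l^2 + x_k^2 x_j\<close> plus terms for \<open>i\<close> and
  \<open>j\<close>; the longest configuration is the loop \<open>i\<close>, \<open>k\<close>,
  \<open>j\<close>. The bounds \<open>less\<close> rule out the bad exponents 1 at \<open>i\<close>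
  and \<open>j\<close>.\<close>

lemma hypersurface_square:
  fixes a :: weights
  assumes dist: "distinct [i, j, k, l]" and pos: "\<And>i. 0 < a i"
    and l: "d = 2 * a l" and k: "d = 2 * a k + a j"
    and less: "a i + a j < d" "a i + a k < d"
    and i: "a i dvd d \<or> a i dvd d - a k" and j: "a j dvd d \<or> a j dvd d - a i"
  shows "\<exists>\<phi>. quasi_homogeneous a d \<phi> \<and> quasi_smooth \<phi>"
proof -
  define s where "s = id(i := if a i dvd d then i else k, j := if a j dvd d then j else i, k := j, l := l)"
  have s: "s i = (if a i dvd d then i else k)" "s j = (if a j dvd d then j else i)" "s k = j" "s l = l"
    using dist by (auto simp: s_def)
  note U = UNIV_4_distinct[OF dist]
  show ?thesis
  proof (rule graph_hypersurface[OF pos])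
    fix x y
    show "a (s x) < d"
      using U[of x] pos[of i] pos[of j] pos[of k] pos[of l] less l by (auto simp: s)
    show "a x dvd d - a (s x)"
    proof -
      have "d - a j = 2 * a k" "d - a l = a l" using k l by linarith+
      then have "a k dvd d - a j" "a l dvd d - a l" by (metis dvd_triv_right, simp)
      then show ?thesis using U[of x] i j by (auto simp: s)
    qed
    show "x = y \<or> s x = x \<or> s y = y" if "s x = s y"
      using that U[of x] U[of y] dist by (auto simp: s split: if_splits)
    show "s (s x) = s x \<or> s (s x) = x \<or> a (s x) + a (s (s x)) \<noteq> d" if "s x \<noteq> x"
      using that U[of x] less k pos[of k] by (auto simp: s split: if_splits)
  qed
qed

text \<open>Starting from \<open>x_k^2 x_j + x_l^2 x_i\<close>, the terms for \<open>i\<close> and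
  \<open>j\<close> either end these chains or join them, up to a loop through all four variables.
  The inequalities \<open>ne\<close> keep exponent 1 out of these joins.\<close>

lemma hypersurface_two_chains:
  fixes a :: weights
  assumes dist: "distinct [i, j, k, l]" and pos: "\<And>i. 0 < a i"
    and k: "d = 2 * a k + a j" and l: "d = 2 * a l + a i"
    and ne: "a i + a k \<noteq> d" "a j + a l \<noteq> d"
    and i: "a i dvd d \<or> a i dvd d - a k" and j: "a j dvd d \<or> a j dvd d - a l"
  shows "\<exists>\<phi>. quasi_homogeneous a d \<phi> \<and> quasi_smooth \<phi>"
proof -
  define s where "s = id(i := if a i dvd d then i else k, j := if a j dvd d then j else l, k := j, l := i)"
  have s: "s i = (if a i dvd d then i else k)" "s j = (if a j dvd d then j else l)" "s k = j" "s l = i"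
    using dist by (auto simp: s_def)
  note U = UNIV_4_distinct[OF dist]
  show ?thesis
  proof (rule graph_hypersurface[OF pos])
    fix x y
    show "a (s x) < d" using U[of x] pos[of i] pos[of j] pos[of k] pos[of l] k l by (auto simp: s)
    show "a x dvd d - a (s x)"
    proof -
      have "d - a j = 2 * a k" "d - a i = 2 * a l" using k l by linarith+
      then have "a k dvd d - a j" "a l dvd d - a i" by (metis dvd_triv_right)+
      then show ?thesis using U[of x] i j by (auto simp: s)
    qed
    show "x = y \<or> s x = x \<or> s y = y" if "s x = s y"
      using that U[of x] U[of y] dist by (auto simp: s split: if_splits)
    show "s (s x) = s x \<or> s (s x) = x \<or> a (s x) + a (s (s x)) \<noteq> d" if "s x \<noteq> x"
      using that U[of x] ne k l pos[of k] pos[of l] by (auto simp: s split: if_splits)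
  qed
qed

section \<open>Transfer of divisibilities between members of a series\<close>

text \<open>Here \<open>a i\<close> divides \<open>d - a j = a k\<close>, so it is a common divisor
  of two weights. An arrow into the pair \<open>j\<close>, \<open>k\<close> can thus be replaced by
  a Fermat term.\<close>

lemma dvd_degree_of_xy:
  assumes wf: "well_formed a d" and ne: "i \<noteq> j" "i \<noteq> k" "j \<noteq> k"
    and d: "d = a j + a k" and i: "a i dvd d - a j"
  shows "a i dvd d"
proof -
  have "a i dvd a k" using i d by simp
  then show ?thesis using well_formed_dvd[OF wf ne(2)] by simp
qed

text \<open>A common divisor of \<open>a i\<close> and \<open>a k\<close> divides \<open>d\<close>,
  hence \<open>a j\<close>, and is a unit as a divisor of three weights. Coprimality then reduces
  \<open>a i dvd 2 * a k\<close> to the claim.\<close>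

lemma dvd_2_of_square:
  assumes wf: "well_formed a d" and ne: "i \<noteq> j" "i \<noteq> k" "j \<noteq> k"
    and d: "d = 2 * a k + a j" and i: "a i dvd d - a j"
  shows "a i dvd 2"
proof -
  let ?g = "gcd (a i) (a k)"
  have "?g dvd d" using well_formed_dvd[OF wf ne(2)] by simp
  then have "?g dvd a j" using d
    by (metis dvd_add_right_iff dvd_mult gcd_dvd2)
  then have "?g dvd 1" using well_formed_unit[OF wf ne(1,3,2), of ?g] by simp
  then have "coprime (a i) (a k)" by (simp add: coprime_iff_gcd_eq_1)
  moreover have "a i dvd 2 * a k" using i d by simp
  ultimately show ?thesis by (simp add: coprime_dvd_mult_left_iff)
qed

lemma dvd_shift:
  fixes m :: int
  assumes "m dvd d' - d" "m dvd d" shows "m dvd d'"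
  using dvd_add[OF assms] by simp

text \<open>By \<open>dvd_degree_of_xy\<close>, arrows from \<open>k\<close> or \<open>l\<close>
  into \<open>i\<close> or \<open>j\<close> become Fermat terms. The remaining divisibilities only
  involve \<open>d\<close> and fixed weights, so they survive the shift.\<close>

lemma transfer_xy:
  assumes dist: "distinct [i, j, k, l]" and h: "qs_wf_hypersurface a d \<phi>"
    and d: "d = a i + a j" "d' = a' i + a' j" and a': "a' k = a k" "a' l = a l" "\<And>i. 0 < a' i"
    and less: "a' k < d'" "a' l < d'" and m: "a k dvd d' - d" "a l dvd d' - d"
  shows "\<exists>\<phi>. quasi_homogeneous a' d' \<phi> \<and> quasi_smooth \<phi>"
proof -
  have wf: "well_formed a d" and qh: "quasi_homogeneous a d \<phi>" and qs: "quasi_smooth \<phi>"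
    using h by (auto simp: qs_wf_hypersurface_def)
  note V = quasi_smooth_vertex[OF qh qs] and U = UNIV_4_distinct[OF dist]
  have base: "a p dvd d \<or> a p dvd d - a q" if pq: "p = k \<and> q = l \<or> p = l \<and> q = k" for p q
  proof -
    obtain r where r: "a p dvd d - a r" by (rule V)
    consider "r = i" | "r = j" | "r = p" | "r = q" using U[of r] pq by blast
    then show ?thesis
    proof cases
      case 1 then show ?thesis using dvd_degree_of_xy[OF wf, of p i j] r d dist pq by auto
    next
      case 2 then show ?thesis using dvd_degree_of_xy[OF wf, of p j i] r d dist pq by auto
    next
      case 3 then show ?thesis using r by (metis dvd_diffD1 dvd_refl diff_add_cancel dvd_add)
    qed (use r in auto)
  qed
  have k: "a' k dvd d' \<or> a' k dvd d' - a' l"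
    using base[of k l] dvd_shift[of "a k" d' d] dvd_shift[of "a k" "d' - a l" "d - a l"] m a' by auto
  have l: "a' l dvd d' \<or> a' l dvd d' - a' k"
    using base[of l k] dvd_shift[of "a l" d' d] dvd_shift[of "a l" "d' - a k" "d - a k"] m a' by auto
  show ?thesis by (rule hypersurface_xy[OF dist a'(3) d(2) less k l])
qed

text \<open>From \<open>i\<close>, an arrow to \<open>j\<close> gives \<open>a i dvd 2\<close> with
  \<open>d\<close> even, and one to \<open>l\<close> gives \<open>a i dvd a l\<close>; from
  \<open>j\<close>, arrows to \<open>k\<close> or \<open>l\<close> give \<open>a j dvd a k\<close>
  or \<open>a j dvd a l\<close>. In all these cases the Fermat term is available.\<close>

lemma transfer_square:
  assumes dist: "distinct [i, j, k, l]" and h: "qs_wf_hypersurface a d \<phi>"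
    and d: "d = 2 * a l" "d = 2 * a k + a j" "d' = 2 * a' l" "d' = 2 * a' k + a' j"
    and a': "a' i = a i" "a' j = a j" "\<And>i. 0 < a' i"
    and less: "a' i + a' j < d'" "a' i + a' k < d'"
    and m: "a i dvd d' - d" "a j dvd d' - d" "a i dvd a' k - a k"
  shows "\<exists>\<phi>. quasi_homogeneous a' d' \<phi> \<and> quasi_smooth \<phi>"
proof -
  have wf: "well_formed a d" and qh: "quasi_homogeneous a d \<phi>" and qs: "quasi_smooth \<phi>"
    using h by (auto simp: qs_wf_hypersurface_def)
  note V = quasi_smooth_vertex[OF qh qs] and U = UNIV_4_distinct[OF dist]
  have "a i dvd d \<or> a i dvd d - a k"
  proof -
    obtain r where r: "a i dvd d - a r" by (rule V)
    consider "r = i" | "r = j" | "r = k" | "r = l" using U[of r] by blast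
    then show ?thesis
    proof cases
      case 1 then show ?thesis using r by (metis dvd_refl diff_add_cancel dvd_add)
    next
      case 2
      then have "a i dvd 2" using dvd_2_of_square[OF wf, of i j k] r d dist by auto
      then show ?thesis using d by simp
    qed (use r d in auto)
  qed
  then have i: "a' i dvd d' \<or> a' i dvd d' - a' k"
    using dvd_shift[OF m(1)] dvd_shift[of "a i" "d' - a' k" "d - a k"] dvd_diff[OF m(1,3)] a'
    by (auto simp: algebra_simps)
  have "a j dvd d \<or> a j dvd d - a i"
  proof -
    obtain r where r: "a j dvd d - a r" by (rule V)
    consider "r = i" | "r = j" | "r = k" | "r = l" using U[of r] by blast
    then show ?thesis
    proof cases
      case 2 then show ?thesis using r by (metis dvd_refl diff_add_cancel dvd_add)
    next
      case 3
      then have "a j dvd a k + a j" using r d(2) by simp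
      then show ?thesis by (simp add: d(2))
    qed (use r d(1) in auto)
  qed
  then have j: "a' j dvd d' \<or> a' j dvd d' - a' i"
    using dvd_shift[OF m(2)] dvd_shift[of "a j" "d' - a i" "d - a i"] m a' by auto
  show ?thesis by (rule hypersurface_square[OF dist a'(3) d(3,4) less i j])
qed

text \<open>An arrow to \<open>j\<close> yields \<open>a i dvd 2\<close> and one to \<open>l\<close>
  yields \<open>a i dvd a l\<close>; either implies \<open>a i dvd d\<close> because
  \<open>d = 2 * a l + a i\<close>.\<close>

lemma two_chains_dvd:
  assumes dist: "distinct [i, j, k, l]"
    and wf: "well_formed a d" and qh: "quasi_homogeneous a d \<phi>" and qs: "quasi_smooth \<phi>"
    and d: "d = 2 * a k + a j" "d = 2 * a l + a i"
  shows "a i dvd d \<or> a i dvd d - a k"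
proof -
  obtain r where r: "a i dvd d - a r" by (rule quasi_smooth_vertex[OF qh qs])
  consider "r = i" | "r = j" | "r = k" | "r = l" using UNIV_4_distinct[OF dist, of r] by blast
  then show ?thesis
  proof cases
    case 1 then show ?thesis using r by (metis dvd_refl diff_add_cancel dvd_add)
  next
    case 2
    then have "a i dvd 2" using dvd_2_of_square[OF wf, of i j k] r d dist by auto
    then show ?thesis using d(2) by simp
  next
    case 4
    then have "a i dvd a l + a i" using r d(2) by simp
    then show ?thesis using d(2) by simp
  qed (use r in auto)
qed

lemma transfer_two_chains:
  assumes dist: "distinct [i, j, k, l]" and h: "qs_wf_hypersurface a d \<phi>"
    and d: "d = 2 * a k + a j" "d = 2 * a l + a i" "d' = 2 * a' k + a' j" "d' = 2 * a' l + a' i"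
    and a': "a' i = a i" "a' j = a j" "\<And>i. 0 < a' i"
    and ne: "a' i + a' k \<noteq> d'" "a' j + a' l \<noteq> d'"
    and m: "a i dvd d' - d" "a j dvd d' - d" "a i dvd a' k - a k" "a j dvd a' l - a l"
  shows "\<exists>\<phi>. quasi_homogeneous a' d' \<phi> \<and> quasi_smooth \<phi>"
proof -
  have wf: "well_formed a d" and qh: "quasi_homogeneous a d \<phi>" and qs: "quasi_smooth \<phi>"
    using h by (auto simp: qs_wf_hypersurface_def)
  \<comment> \<open>The situation is symmetric under exchanging \<open>i\<close> with
    \<open>j\<close> and \<open>k\<close> with \<open>l\<close>, so \<open>two_chains_dvd\<close>
    serves both variables.\<close>
  have dist': "distinct [j, i, l, k]" using dist by auto
  have i: "a' i dvd d' \<or> a' i dvd d' - a' k"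
    using two_chains_dvd[OF dist wf qh qs d(1,2)] dvd_shift[OF m(1)]
      dvd_shift[of "a i" "d' - a' k" "d - a k"] dvd_diff[OF m(1,3)] a'
    by (auto simp: algebra_simps)
  have j: "a' j dvd d' \<or> a' j dvd d' - a' l"
    using two_chains_dvd[OF dist' wf qh qs d(2,1)] dvd_shift[OF m(2)]
      dvd_shift[of "a j" "d' - a' l" "d - a l"] dvd_diff[OF m(2,4)] a'
    by (auto simp: algebra_simps)
  show ?thesis by (rule hypersurface_two_chains[OF dist a'(3) d(3,4) ne i j])
qed

section \<open>Concrete weights and the six classes\<close>

lemma wts_simps [simp]:
  "wts p q r t 0 = p" "wts p q r t 1 = q" "wts p q r t 2 = r" "wts p q r t 3 = t"
  by (simp_all add: wts_def)

lemma all_4: "(\<forall>i::4. P i) \<longleftrightarrow> P 0 \<and> P 1 \<and> P 2 \<and> P 3"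
  using UNIV_4_distinct[of 0 1 2 3] by (auto; metis)

lemma qs_wf_hypersurface_wts:
  assumes "\<exists>\<phi>. quasi_homogeneous (wts p q r t) d \<phi> \<and> quasi_smooth \<phi>"
    and "well_formed (wts p q r t) d" "0 < p" "0 < q" "0 < r" "0 < t"
  shows "\<exists>\<phi>. qs_wf_hypersurface (wts p q r t) d \<phi>"
  using assms by (auto simp: qs_wf_hypersurface_def all_4)

lemma well_formed_wts_cong:
  assumes wf: "well_formed (wts p q r t) d"
    and m: "m dvd p' - p" "m dvd q' - q" "m dvd r' - r" "m dvd t' - t" "m dvd d' - d"
    and triple: "\<And>g. g dvd p' \<Longrightarrow> g dvd q' \<Longrightarrow> g dvd r' \<Longrightarrow> g dvd m"
      "\<And>g. g dvd p' \<Longrightarrow> g dvd q' \<Longrightarrow> g dvd t' \<Longrightarrow> g dvd m"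
      "\<And>g. g dvd p' \<Longrightarrow> g dvd r' \<Longrightarrow> g dvd t' \<Longrightarrow> g dvd m"
      "\<And>g. g dvd q' \<Longrightarrow> g dvd r' \<Longrightarrow> g dvd t' \<Longrightarrow> g dvd m"
    and pair: "\<And>g. g dvd p' \<Longrightarrow> g dvd q' \<Longrightarrow> g dvd m \<or> g dvd d'"
      "\<And>g. g dvd p' \<Longrightarrow> g dvd r' \<Longrightarrow> g dvd m \<or> g dvd d'"
      "\<And>g. g dvd p' \<Longrightarrow> g dvd t' \<Longrightarrow> g dvd m \<or> g dvd d'"
      "\<And>g. g dvd q' \<Longrightarrow> g dvd r' \<Longrightarrow> g dvd m \<or> g dvd d'"
      "\<And>g. g dvd q' \<Longrightarrow> g dvd t' \<Longrightarrow> g dvd m \<or> g dvd d'"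
      "\<And>g. g dvd r' \<Longrightarrow> g dvd t' \<Longrightarrow> g dvd m \<or> g dvd d'"
  shows "well_formed (wts p' q' r' t') d'"
proof (rule well_formed_cong[OF wf])
  show "m dvd wts p' q' r' t' i - wts p q r t i" for i
    using m UNIV_4_distinct[of 0 1 2 3 i] by auto
  show "m dvd d' - d" by fact
  show "g dvd m" if "i \<noteq> j" "j \<noteq> k" "i \<noteq> k"
    "g dvd wts p' q' r' t' i" "g dvd wts p' q' r' t' j" "g dvd wts p' q' r' t' k" for i j k g
    using that triple[of g] UNIV_4_distinct[of 0 1 2 3 i] UNIV_4_distinct[of 0 1 2 3 j]
      UNIV_4_distinct[of 0 1 2 3 k] by auto
  show "g dvd m \<or> g dvd d'" if "i \<noteq> j"
    "g dvd wts p' q' r' t' i" "g dvd wts p' q' r' t' j" for i j g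
    using that pair[of g] UNIV_4_distinct[of 0 1 2 3 i] UNIV_4_distinct[of 0 1 2 3 j] by auto
qed

theorem theorem8:
  fixes n :: nat and I :: int and S :: "(int \<times> int \<times> int \<times> int \<times> int) set"
    and c0 c1 c2 c3 e c0' c1' c2' c3' e' :: int
  assumes "series n I S"
    and "(c0, c1, c2, c3, e) \<in> S"
    and "\<exists>\<phi>. qs_wf_hypersurface (wts c0 c1 c2 c3) e \<phi>"
    and "(c0', c1', c2', c3', e') \<in> S"
  shows "\<exists>\<phi>. qs_wf_hypersurface (wts c0' c1' c2' c3') e' \<phi>"
proof -
  let ?w = "wts c0 c1 c2 c3" and ?w' = "wts c0' c1' c2' c3'"
  obtain \<phi> where h: "qs_wf_hypersurface ?w e \<phi>" using assms(3) by blast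
  then have wf: "well_formed ?w e" by (simp add: qs_wf_hypersurface_def)
  have ord: "0 < c0'" "c0' \<le> c1'" "c1' \<le> c2'" "c2' \<le> c3'"
  proof -
    have "ordered (c0', c1', c2', c3', e')" using assms(1) by cases (use assms(4) in blast)+
    then show "0 < c0'" "c0' \<le> c1'" "c1' \<le> c2'" "c2' \<le> c3'" by simp_all
  qed
  then have pos: "0 < c0'" "0 < c1'" "0 < c2'" "0 < c3'" and pos': "0 < ?w' i" for i
    using UNIV_4_distinct[of 0 1 2 3 i] by auto
  have "(\<exists>\<phi>. quasi_homogeneous ?w' e' \<phi> \<and> quasi_smooth \<phi>) \<and> well_formed ?w' e'"
    using assms(1)
  proof cases
    case (class1 a0 a1 b2 b3 m)
    obtain x y where cx: "c0 = a0" "c1 = a1" "c2 = b2 + x * m" "c3 = b3 + y * m" "e = b2 + b3 + (x + y) * m"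
      using assms(2) unfolding class1(2) mem_Collect_eq prod.inject by blast
    obtain x' y' where cx': "c0' = a0" "c1' = a1" "c2' = b2 + x' * m" "c3' = b3 + y' * m" "e' = b2 + b3 + (x' + y') * m"
      using assms(4) unfolding class1(2) mem_Collect_eq prod.inject by blast
    have c: "c0 = a0" "c1 = a1" "e = c2 + c3" using cx by (simp_all add: algebra_simps)
    have c': "c0' = a0" "c1' = a1" "e' = c2' + c3'" using cx' by (simp_all add: algebra_simps)
    have dm: "a0 dvd m" "a1 dvd m" using class1 by auto
    have m: "m dvd c2' - c2" "m dvd c3' - c3" "m dvd e' - e"
      using cx cx' by (auto simp: algebra_simps)
    \<comment> \<open>This covers every pair and triple except \<open>c2'\<close>,
      \<open>c3'\<close>, whose common divisors divide their sum \<open>e'\<close>.\<close>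
    have gm: "g dvd m" if "g dvd a0 \<or> g dvd a1" for g using that dm dvd_trans by blast
    have "\<exists>\<phi>. quasi_homogeneous ?w' e' \<phi> \<and> quasi_smooth \<phi>"
      by (rule transfer_xy[OF _ h, of 2 3 0 1])
        (use pos pos' ord c c' dvd_trans[OF dm(1) m(3)] dvd_trans[OF dm(2) m(3)] in auto)
    moreover have "well_formed ?w' e'"
      by (rule well_formed_wts_cong[OF wf, of m]) (use c c' m gm in auto)
    ultimately show ?thesis ..
  next
    case (class2 a0 a1 a2 b3 m)
    obtain x where cx: "c0 = a0" "c1 = a1" "c2 = a2" "c3 = b3 + x * m" "e = a1 + b3 + x * m"
      using assms(2) unfolding class2(2) mem_Collect_eq prod.inject by blast
    obtain x' where cx': "c0' = a0" "c1' = a1" "c2' = a2" "c3' = b3 + x' * m" "e' = a1 + b3 + x' * m"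
      using assms(4) unfolding class2(2) mem_Collect_eq prod.inject by blast
    have c: "c0 = a0" "c1 = a1" "c2 = a2" "e = c1 + c3" using cx by (simp_all add: algebra_simps)
    have c': "c0' = a0" "c1' = a1" "c2' = a2" "e' = c1' + c3'" using cx' by (simp_all add: algebra_simps)
    have dm: "a0 dvd m" "a1 dvd m" "a2 dvd m" using class2 by (auto intro: dvd_lcmI1 dvd_lcmI2)
    have m: "m dvd c3' - c3" "m dvd e' - e"
      using cx cx' by (auto simp: algebra_simps)
    \<comment> \<open>Any two of the four weights include one of the fixed ones, so this settles all
      pairs and triples.\<close>
    have gm: "g dvd m" if "g dvd a0 \<or> g dvd a1 \<or> g dvd a2" for g using that dm dvd_trans by blast
    have "\<exists>\<phi>. quasi_homogeneous ?w' e' \<phi> \<and> quasi_smooth \<phi>"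
      by (rule transfer_xy[OF _ h, of 1 3 0 2])
        (use pos pos' ord c c' dvd_trans[OF dm(1) m(2)] dvd_trans[OF dm(3) m(2)] in auto)
    moreover have "well_formed ?w' e'"
      by (rule well_formed_wts_cong[OF wf, of m]) (use c c' m gm in auto)
    ultimately show ?thesis ..
  next
    case (class3 a0 a1 a2 b3 m)
    obtain x where cx: "c0 = a0" "c1 = a1" "c2 = a2" "c3 = b3 + x * m" "e = a0 + b3 + x * m"
      using assms(2) unfolding class3(2) mem_Collect_eq prod.inject by blast
    obtain x' where cx': "c0' = a0" "c1' = a1" "c2' = a2" "c3' = b3 + x' * m" "e' = a0 + b3 + x' * m"
      using assms(4) unfolding class3(2) mem_Collect_eq prod.inject by blast
    have c: "c0 = a0" "c1 = a1" "c2 = a2" "e = c0 + c3" using cx by (simp_all add: algebra_simps)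
    have c': "c0' = a0" "c1' = a1" "c2' = a2" "e' = c0' + c3'" using cx' by (simp_all add: algebra_simps)
    have dm: "a0 dvd m" "a1 dvd m" "a2 dvd m" using class3 by (auto intro: dvd_lcmI1 dvd_lcmI2)
    have m: "m dvd c3' - c3" "m dvd e' - e"
      using cx cx' by (auto simp: algebra_simps)
    have gm: "g dvd m" if "g dvd a0 \<or> g dvd a1 \<or> g dvd a2" for g using that dm dvd_trans by blast
    have "\<exists>\<phi>. quasi_homogeneous ?w' e' \<phi> \<and> quasi_smooth \<phi>"
      by (rule transfer_xy[OF _ h, of 0 3 1 2])
        (use pos pos' ord c c' dvd_trans[OF dm(2) m(2)] dvd_trans[OF dm(3) m(2)] in auto)
    moreover have "well_formed ?w' e'"
      by (rule well_formed_wts_cong[OF wf, of m]) (use c c' m gm in auto)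
    ultimately show ?thesis ..
  next
    case (class4 a0 a1 b2 m)
    obtain q where q: "a1 = 2 * q" using class4 by auto
    obtain x where cx: "c0 = a0" "c1 = a1" "c2 = b2 + x * m" "c3 = a1 div 2 + b2 + x * m" "e = a1 + 2 * b2 + 2 * x * m"
      using assms(2) unfolding class4(2) mem_Collect_eq prod.inject by blast
    obtain x' where cx': "c0' = a0" "c1' = a1" "c2' = b2 + x' * m" "c3' = a1 div 2 + b2 + x' * m" "e' = a1 + 2 * b2 + 2 * x' * m"
      using assms(4) unfolding class4(2) mem_Collect_eq prod.inject by blast
    have c: "c0 = a0" "c1 = a1" "c3 = q + c2" "e = 2 * c2 + c1" using cx q by (simp_all add: algebra_simps)
    have c': "c0' = a0" "c1' = a1" "c3' = q + c2'" "e' = 2 * c2' + c1'" using cx' q by (simp_all add: algebra_simps)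
    have dm: "a0 dvd m" "q dvd m" using class4 q by auto
    have m: "m dvd c2' - c2" "m dvd c3' - c3" "2 * m dvd e' - e"
      using cx cx' by (auto simp: algebra_simps)
    \<comment> \<open>Only \<open>q\<close>, half of \<open>a1\<close>, is known to divide
      \<open>m\<close>; the factor 2 in \<open>e' - e\<close> makes up for it.\<close>
    have m2: "m dvd e' - e" "a1 dvd e' - e"
      using m(3) q dm by (auto intro: dvd_trans[OF _ m(3)])
    have gm: "g dvd m" if "g dvd a0 \<or> g dvd q" for g using that dm dvd_trans by blast
    have gq: "g dvd m" if "g dvd c2'" "g dvd c3'" for g
      using gm[of g] dvd_diff[OF that(2,1)] c' by simp
    \<comment> \<open>Since \<open>a1\<close> may fail to divide \<open>m\<close>, pairs without
      \<open>c0'\<close> are checked against the degree directly.\<close>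
    have ge: "g dvd e'" if "g dvd c1' \<and> g dvd c2' \<or> g dvd c3'" for g
    proof -
      have "e' = c1' + 2 * c2'" "e' = 2 * c3'" using c' q by simp_all
      then show ?thesis using that by (metis dvd_add dvd_mult)
    qed
    have "\<exists>\<phi>. quasi_homogeneous ?w' e' \<phi> \<and> quasi_smooth \<phi>"
      by (rule transfer_square[OF _ h, of 0 1 2 3])
        (use pos pos' ord c c' q dvd_trans[OF dm(1) m2(1)] m2(2) dvd_trans[OF dm(1) m(1)] in auto)
    moreover have "well_formed ?w' e'"
      by (rule well_formed_wts_cong[OF wf, of m])
        (use c(1,2) c'(1,2) m m2 gm gq ge in auto)
    ultimately show ?thesis ..
  next
    case (class5 a0 a1 b2 m)
    obtain q where q: "a0 = 2 * q" using class5 by auto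
    obtain x where cx: "c0 = a0" "c1 = a1" "c2 = b2 + x * m" "c3 = a0 div 2 + b2 + x * m" "e = a0 + 2 * b2 + 2 * x * m"
      using assms(2) unfolding class5(2) mem_Collect_eq prod.inject by blast
    obtain x' where cx': "c0' = a0" "c1' = a1" "c2' = b2 + x' * m" "c3' = a0 div 2 + b2 + x' * m" "e' = a0 + 2 * b2 + 2 * x' * m"
      using assms(4) unfolding class5(2) mem_Collect_eq prod.inject by blast
    have c: "c0 = a0" "c1 = a1" "c3 = q + c2" "e = 2 * c2 + c0" using cx q by (simp_all add: algebra_simps)
    have c': "c0' = a0" "c1' = a1" "c3' = q + c2'" "e' = 2 * c2' + c0'" using cx' q by (simp_all add: algebra_simps)
    have dm: "a1 dvd m" "q dvd m" using class5 q by auto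
    have m: "m dvd c2' - c2" "m dvd c3' - c3" "2 * m dvd e' - e"
      using cx cx' by (auto simp: algebra_simps)
    have m2: "m dvd e' - e" "a0 dvd e' - e"
      using m(3) q dm by (auto intro: dvd_trans[OF _ m(3)])
    have gm: "g dvd m" if "g dvd a1 \<or> g dvd q" for g using that dm dvd_trans by blast
    have gq: "g dvd m" if "g dvd c2'" "g dvd c3'" for g
      using gm[of g] dvd_diff[OF that(2,1)] c' by simp
    have ge: "g dvd e'" if "g dvd c0' \<and> g dvd c2' \<or> g dvd c3'" for g
    proof -
      have "e' = c0' + 2 * c2'" "e' = 2 * c3'" using c' q by simp_all
      then show ?thesis using that by (metis dvd_add dvd_mult)
    qed
    have "\<exists>\<phi>. quasi_homogeneous ?w' e' \<phi> \<and> quasi_smooth \<phi>"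
      \<comment> \<open>As in class 4 with \<open>x_0\<close> and \<open>x_1\<close> exchanged: the
        forced monomials are \<open>x_3^2\<close> and \<open>x_2^2 x_0\<close>.\<close>
      by (rule transfer_square[OF _ h, of 1 0 2 3])
        (use pos pos' ord c c' q dvd_trans[OF dm(1) m2(1)] m2(2) dvd_trans[OF dm(1) m(1)] in auto)
    moreover have "well_formed ?w' e'"
      by (rule well_formed_wts_cong[OF wf, of m])
        (use c(1,2) c'(1,2) m m2 gm gq ge in auto)
    ultimately show ?thesis ..
  next
    case (class6 k a m)
    obtain x where cx: "c0 = I - k" "c1 = I + k" "c2 = a + x * m" "c3 = a + k + x * m" "e = 2 * a + I + k + 2 * x * m"
      using assms(2) unfolding class6(2) mem_Collect_eq prod.inject by blast
    obtain x' where cx': "c0' = I - k" "c1' = I + k" "c2' = a + x' * m" "c3' = a + k + x' * m" "e' = 2 * a + I + k + 2 * x' * m"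
      using assms(4) unfolding class6(2) mem_Collect_eq prod.inject by blast
    have c: "c0 = I - k" "c1 = I + k" "c3 = c2 + k" "e = 2 * c2 + c1" using cx by (simp_all add: algebra_simps)
    have c': "c0' = I - k" "c1' = I + k" "c3' = c2' + k" "e' = 2 * c2' + c1'" using cx' by (simp_all add: algebra_simps)
    have dm: "I - k dvd m" "I + k dvd m" "k dvd m" using class6 by (auto intro: dvd_lcmI1 dvd_lcmI2)
    have m: "m dvd c2' - c2" "m dvd c3' - c3" "m dvd e' - e"
      using cx cx' by (auto simp: algebra_simps)
    have gm: "g dvd m" if "g dvd I - k \<or> g dvd I + k \<or> g dvd k" for g using that dm dvd_trans by blast
    have gk: "g dvd m" if "g dvd c2'" "g dvd c3'" for g
      using gm[of g] dvd_diff[OF that(2,1)] c' by simp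
    have "\<exists>\<phi>. quasi_homogeneous ?w' e' \<phi> \<and> quasi_smooth \<phi>"
      \<comment> \<open>The forced monomials are \<open>x_2^2 x_1\<close> and
        \<open>x_3^2 x_0\<close>. Equality \<open>c1' + c3' = e'\<close> would mean
        \<open>c2' = k\<close>, which the ordering excludes:
        \<open>k < I + k = c1' \<le> c2'\<close>.\<close>
      by (rule transfer_two_chains[OF _ h, of 0 1 2 3])
        (use pos pos' ord c c' class6(4,6) dvd_trans[OF dm(1) m(3)] dvd_trans[OF dm(2) m(3)]
          dvd_trans[OF dm(1) m(1)] dvd_trans[OF dm(2) m(2)] in auto)
    moreover have "well_formed ?w' e'"
      by (rule well_formed_wts_cong[OF wf, of m]) (use c c' m gm gk in auto)
    ultimately show ?thesis ..
  qed
  then show ?thesis using qs_wf_hypersurface_wts pos by blast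
qed

end
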